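(* There is a three-stage chain MDP (with discount $\gamma\in(0,1)$ and initial/training distribution $\mu$ concentrated at the first stage) and policies $\pi_\epsilon$, $\epsilon\in(0,1)$, such that, with $J=J_\mu$ and $J^\star=\max_{\pi\in\Pi}J_\mu(\pi)$, $$J^\star-J(\pi_\epsilon)=\gamma^2\epsilon^3,\qquad R_{\mathrm{pol}}(\pi_\epsilon)^2=\tfrac32\gamma^4\epsilon^4.$$ Therefore no finite constant $C$ can satisfy $J^\star-J(\pi)\le C\,R_{\mathrm{pol}}(\pi)^2$ for all direct tabular policies $\pi\in\Pi$.
   Context: A three-stage chain is an MDP with states $s_0,s_1,s_2$ and an absorbing zero-reward terminal state $s_T$, with two actions "stop" (move to $s_T$) and "continue" (move to the next state in the chain $s_0\to s_1\to s_2\to s_T$). For a finite discounted MDP with kernel $P$, reward $r$ and discount $\gamma$, and $\pi\in\Pi=\prod_s\Delta(\mathcal A)$: $P_\pi(s,s')=\sum_a\pi(a|s)P(s'|s,a)$, $r_\pi(s)=\sum_a\pi(a|s)r(s,a)$, $M_\pi=I-\gamma P_\pi$, $V^\pi=M_\pi^{-1}r_\pi$, $J_\mu(\pi)=\mu^{\mathsf T}V^\pi$, $F_\mu=-J_\mu$, and $R_{\mathrm{pol}}(\pi)=\operatorname{dist}(0,\nabla F_\mu(\pi)+N_\Pi(\pi))$ (Euclidean distance), where $N_\Pi$ is the normal cone of $\Pi$ and the gradient is with respect to the coordinates $\pi(a|s)$. *)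

theory Defs
  imports "HOL-Analysis.Analysis" "HOL-Probability.Probability_Mass_Function"
begin

record ('s, 'a) mdp =
  kernel :: "'s \<Rightarrow> 'a \<Rightarrow> 's pmf"
  reward :: "'s \<Rightarrow> 'a \<Rightarrow> real"
  discount :: real

text \<open>A direct tabular policy is a point of the Euclidean space \<open>real ^ 'a ^ 's\<close>, with
  \<open>\<pi> $ s $ a\<close> the probability \<open>\<pi>(a|s)\<close>. All quantities below are defined by the same formulas for
  points outside the policy polytope, so that derivatives in the coordinates
  \<open>\<pi>(a|s)\<close> make sense.\<close>

definition policies :: "(real ^ 'a::finite ^ 's::finite) set" where
  "policies = {\<pi>. \<forall>s. (\<forall>a. 0 \<le> \<pi> $ s $ a) \<and> (\<Sum>a\<in>UNIV. \<pi> $ s $ a) = 1}"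

definition policy_kernel :: "('s::finite, 'a::finite) mdp \<Rightarrow> real ^ 'a ^ 's \<Rightarrow> real ^ 's ^ 's" where
  "policy_kernel M \<pi> = (\<chi> s s'. \<Sum>a\<in>UNIV. \<pi> $ s $ a * pmf (kernel M s a) s')"

definition policy_reward :: "('s::finite, 'a::finite) mdp \<Rightarrow> real ^ 'a ^ 's \<Rightarrow> real ^ 's" where
  "policy_reward M \<pi> = (\<chi> s. \<Sum>a\<in>UNIV. \<pi> $ s $ a * reward M s a)"

definition value_matrix :: "('s::finite, 'a::finite) mdp \<Rightarrow> real ^ 'a ^ 's \<Rightarrow> real ^ 's ^ 's" where
  "value_matrix M \<pi> = mat 1 - discount M *\<^sub>R policy_kernel M \<pi>"

definition policy_value :: "('s::finite, 'a::finite) mdp \<Rightarrow> real ^ 'a ^ 's \<Rightarrow> real ^ 's" where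
  "policy_value M \<pi> = matrix_inv (value_matrix M \<pi>) *v policy_reward M \<pi>"

definition expected_return :: "('s::finite, 'a::finite) mdp \<Rightarrow> 's pmf \<Rightarrow> real ^ 'a ^ 's \<Rightarrow> real" where
  "expected_return M \<mu> \<pi> = (\<chi> s. pmf \<mu> s) \<bullet> policy_value M \<pi>"

definition gradient :: "('v::real_inner \<Rightarrow> real) \<Rightarrow> 'v \<Rightarrow> 'v" where
  "gradient f x = (THE D. GDERIV f x :> D)"

definition normal_cone :: "'v::real_inner set \<Rightarrow> 'v \<Rightarrow> 'v set" where
  "normal_cone C x = {v. x \<in> C \<and> (\<forall>y\<in>C. v \<bullet> (y - x) \<le> 0)}"

definition policy_residual :: "('s::finite, 'a::finite) mdp \<Rightarrow> 's pmf \<Rightarrow> real ^ 'a ^ 's \<Rightarrow> real" where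
  "policy_residual M \<mu> \<pi> =
     infdist 0 ((+) (gradient (\<lambda>p. - expected_return M \<mu> p) \<pi>) ` normal_cone policies \<pi>)"

datatype stage = S0 | S1 | S2 | Terminal

datatype choice = Stop | Continue

instance stage :: finite
proof
  have "(UNIV :: stage set) \<subseteq> {S0, S1, S2, Terminal}"
    using stage.exhaust by auto
  then show "finite (UNIV :: stage set)"
    by (rule finite_subset) simp
qed

instance choice :: finite
proof
  have "(UNIV :: choice set) \<subseteq> {Stop, Continue}"
    using choice.exhaust by auto
  then show "finite (UNIV :: choice set)"
    by (rule finite_subset) simp
qed

fun next_stage :: "stage \<Rightarrow> stage" where
  "next_stage S0 = S1"
| "next_stage S1 = S2"
| "next_stage S2 = Terminal"
| "next_stage Terminal = Terminal"

fun chain_step :: "stage \<Rightarrow> choice \<Rightarrow> stage" where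
  "chain_step s Stop = Terminal"
| "chain_step s Continue = next_stage s"

definition three_stage_chain :: "(stage, choice) mdp \<Rightarrow> bool" where
  "three_stage_chain M \<longleftrightarrow>
     (\<forall>s a. kernel M s a = return_pmf (chain_step s a)) \<and>
     (\<forall>a. reward M Terminal a = 0) \<and>
     0 < discount M \<and> discount M < 1"

end

theory Submission
  imports Defs
begin

text \<open>Pay \<open>-1\<close> for continuing out of the last stage and nothing otherwise. With \<open>c\<^sub>i\<close> the
  probability of continuing at stage \<open>i\<close>, the return is \<open>-\<gamma>\<^sup>2 c\<^sub>0 c\<^sub>1 c\<^sub>2\<close>, which is maximal, with value
  \<open>0\<close>, when all \<open>c\<^sub>i\<close> vanish. At \<open>c\<^sub>i = \<epsilon>\<close> the gap is \<open>\<gamma>\<^sup>2 \<epsilon>\<^sup>3\<close>, while every partial derivative is only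
  \<open>\<gamma>\<^sup>2 \<epsilon>\<^sup>2\<close>. The policy is interior, so the residual is the length of the projection of the
  gradient onto the directions that sum to zero in every state; this halves the squared length.\<close>

lemma UNIV_stage: "(UNIV :: stage set) = {S0, S1, S2, Terminal}"
  using stage.exhaust by auto

lemma UNIV_choice: "(UNIV :: choice set) = {Stop, Continue}"
  using choice.exhaust by auto

lemma sum_stage: "(\<Sum>s\<in>UNIV. f s) = f S0 + f S1 + f S2 + f Terminal"
  for f :: "stage \<Rightarrow> 'b::comm_monoid_add"
  by (simp add: UNIV_stage add.assoc)

lemma sum_choice: "(\<Sum>a\<in>UNIV. f a) = f Stop + f Continue"
  for f :: "choice \<Rightarrow> 'b::comm_monoid_add"
  by (simp add: UNIV_choice)

lemma forall_stage: "(\<forall>s. P s) \<longleftrightarrow> P S0 \<and> P S1 \<and> P S2 \<and> P Terminal"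
  by (metis stage.exhaust)

text \<open>A square matrix with trivial kernel is invertible, so a value function can be guessed
  and checked against the Bellman equation, with no inverse ever computed.\<close>

lemma matrix_inv_mult_vec_eq:
  fixes A :: "real ^ 'n ^ 'n"
  assumes ker: "\<And>x. A *v x = 0 \<Longrightarrow> x = 0" and "A *v v = b"
  shows "matrix_inv A *v b = v"
proof -
  have "invertible A"
    using ker by (auto simp: invertible_left_inverse matrix_left_invertible_ker)
  then have "matrix_inv A ** A = mat 1"
    unfolding invertible_def matrix_inv_def by (rule someI2_ex) simp
  then show ?thesis
    by (metis assms(2) matrix_vector_mul_assoc matrix_vector_mul_lid)
qed

text \<open>\<open>gradient\<close> is a definite description, hence uniqueness has to be shown: two
  candidates induce the same derivative, and testing it on their difference makes that difference
  zero.\<close>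

lemma gradient_eqI:
  assumes "GDERIV f x :> D"
  shows "gradient f x = D"
  unfolding gradient_def
proof (rule the_equality)
  show "GDERIV f x :> D" by (rule assms)
next
  fix E assume "GDERIV f x :> E"
  then have "(\<lambda>h. h \<bullet> E) = (\<lambda>h. h \<bullet> D)"
    using assms unfolding gderiv_def by (rule has_derivative_unique)
  then have "(E - D) \<bullet> (E - D) = 0"
    unfolding inner_diff_right by (metis diff_self)
  then show "E = D"
    by simp
qed

text \<open>This is the variational inequality for a point of least norm. Cauchy-Schwarz bounds
  \<open>x \<bullet> w\<close> by \<open>norm x * norm w\<close>, and a factor \<open>norm w\<close>
  cancels.\<close>

lemma infdist_zero_eq_normI:
  fixes w :: "'v::real_inner"
  assumes "w \<in> A" and "\<And>x. x \<in> A \<Longrightarrow> w \<bullet> w \<le> x \<bullet> w"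
  shows "infdist 0 A = norm w"
proof (rule antisym)
  show "infdist 0 A \<le> norm w"
    using infdist_le[OF assms(1), of 0] by simp
  have "norm w \<le> norm x" if "x \<in> A" for x
  proof (cases "w = 0")
    case False
    have "norm w * norm w \<le> norm x * norm w"
      using assms(2)[OF that] norm_cauchy_schwarz[of x w]
      by (simp add: power2_eq_square[symmetric] power2_norm_eq_inner)
    then show ?thesis
      using False by simp
  qed simp
  moreover have "A \<noteq> {}"
    using assms(1) by auto
  ultimately show "norm w \<le> infdist 0 A"
    by (simp add: infdist_def cINF_greatest)
qed

definition exit_cost_chain :: "real \<Rightarrow> (stage, choice) mdp" where
  "exit_cost_chain \<gamma> =
     \<lparr>kernel = \<lambda>s a. return_pmf (chain_step s a),
      reward = \<lambda>s a. if s = S2 \<and> a = Continue then - 1 else 0,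
      discount = \<gamma>\<rparr>"

lemma three_stage_exit_cost_chain:
  assumes "0 < \<gamma>" and "\<gamma> < 1"
  shows "three_stage_chain (exit_cost_chain \<gamma>)"
  using assms by (simp add: three_stage_chain_def exit_cost_chain_def)

text \<open>Off the polytope the value matrix can be singular; it is invertible exactly when its
  \<open>Terminal\<close> diagonal entry does not vanish.\<close>

lemma expected_return_exit_cost_chain:
  assumes "\<gamma> * (\<pi> $ Terminal $ Stop + \<pi> $ Terminal $ Continue) \<noteq> 1"
  shows "expected_return (exit_cost_chain \<gamma>) (return_pmf S0) \<pi> =
    - (\<gamma>\<^sup>2 * (\<pi> $ S0 $ Continue * \<pi> $ S1 $ Continue * \<pi> $ S2 $ Continue))"
proof -
  \<comment> \<open>Backward induction from \<open>Terminal\<close>: each entry is \<gamma> times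
    the continuation probability times the next entry, starting from the exit cost at
    \<open>S2\<close>.\<close>
  define v :: "real ^ stage" where "v = (\<chi> s. case s of
      S0 \<Rightarrow> - (\<gamma>\<^sup>2 * (\<pi> $ S0 $ Continue * \<pi> $ S1 $ Continue * \<pi> $ S2 $ Continue))
    | S1 \<Rightarrow> - (\<gamma> * (\<pi> $ S1 $ Continue * \<pi> $ S2 $ Continue))
    | S2 \<Rightarrow> - \<pi> $ S2 $ Continue
    | Terminal \<Rightarrow> 0)"
  have "policy_value (exit_cost_chain \<gamma>) \<pi> = v"
    unfolding policy_value_def
  proof (rule matrix_inv_mult_vec_eq)
    show "value_matrix (exit_cost_chain \<gamma>) \<pi> *v v = policy_reward (exit_cost_chain \<gamma>) \<pi>"
      by (simp add: vec_eq_iff forall_stage matrix_vector_mult_def value_matrix_def mat_def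
          policy_kernel_def policy_reward_def exit_cost_chain_def sum_stage sum_choice v_def
          power2_eq_square)
  next
    fix x :: "real ^ stage"
    assume "value_matrix (exit_cost_chain \<gamma>) \<pi> *v x = 0"
    \<comment> \<open>The matrix is triangular in the order of the stages, so vanishing at
      \<open>Terminal\<close> propagates back to \<open>S0\<close>.\<close>
    then have eqs: "(1 - \<gamma> * (\<pi> $ Terminal $ Stop + \<pi> $ Terminal $ Continue)) * x $ Terminal = 0"
      "x $ S2 = \<gamma> * (\<pi> $ S2 $ Stop + \<pi> $ S2 $ Continue) * x $ Terminal"
      "x $ S1 = \<gamma> * \<pi> $ S1 $ Continue * x $ S2 + \<gamma> * \<pi> $ S1 $ Stop * x $ Terminal"
      "x $ S0 = \<gamma> * \<pi> $ S0 $ Continue * x $ S1 + \<gamma> * \<pi> $ S0 $ Stop * x $ Terminal"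
      by (auto simp: vec_eq_iff forall_stage matrix_vector_mult_def value_matrix_def mat_def
          policy_kernel_def exit_cost_chain_def sum_stage sum_choice diff_eq_eq)
    have "x $ Terminal = 0"
      using eqs(1) assms by simp
    then show "x = 0"
      using eqs(2-4) by (simp add: vec_eq_iff forall_stage)
  qed
  then show ?thesis
    by (simp add: expected_return_def inner_vec_def sum_stage v_def)
qed

lemma expected_return_exit_cost_chain_policy:
  assumes "\<pi> \<in> policies" and "\<gamma> < 1"
  shows "expected_return (exit_cost_chain \<gamma>) (return_pmf S0) \<pi> =
    - (\<gamma>\<^sup>2 * (\<pi> $ S0 $ Continue * \<pi> $ S1 $ Continue * \<pi> $ S2 $ Continue))"
  using assms by (intro expected_return_exit_cost_chain) (simp add: policies_def sum_choice)

text \<open>Uniform across stages, not across actions: every state continues with the same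
  probability. The parameter \<open>0\<close> gives the optimal policy, which always stops.\<close>

definition uniform_policy :: "real \<Rightarrow> real ^ choice ^ stage" where
  "uniform_policy \<epsilon> = (\<chi> s a. if a = Continue then \<epsilon> else 1 - \<epsilon>)"

lemma uniform_policy_in_policies: "0 \<le> \<epsilon> \<Longrightarrow> \<epsilon> \<le> 1 \<Longrightarrow> uniform_policy \<epsilon> \<in> policies"
  by (simp add: policies_def uniform_policy_def sum_choice)

lemma expected_return_uniform_policy:
  assumes "\<gamma> < 1" and "0 \<le> \<epsilon>" and "\<epsilon> \<le> 1"
  shows "expected_return (exit_cost_chain \<gamma>) (return_pmf S0) (uniform_policy \<epsilon>) = - (\<gamma>\<^sup>2 * \<epsilon> ^ 3)"
  using assms
  by (simp add: expected_return_exit_cost_chain_policy uniform_policy_in_policies)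
     (simp add: uniform_policy_def power3_eq_cube)

lemma never_continue_optimal:
  assumes "\<gamma> < 1"
  shows "is_arg_max (expected_return (exit_cost_chain \<gamma>) (return_pmf S0))
    (\<lambda>\<pi>. \<pi> \<in> policies) (uniform_policy 0)"
proof -
  have "expected_return (exit_cost_chain \<gamma>) (return_pmf S0) \<pi> \<le> 0" if "\<pi> \<in> policies" for \<pi>
    using that assms by (simp add: expected_return_exit_cost_chain_policy) (simp add: policies_def)
  then show ?thesis
    using assms by (auto simp: is_arg_max_def uniform_policy_in_policies
        expected_return_uniform_policy not_less)
qed

lemma gradient_uniform_policy:
  assumes "\<gamma> < 1"
  shows "gradient (\<lambda>\<pi>. - expected_return (exit_cost_chain \<gamma>) (return_pmf S0) \<pi>) (uniform_policy \<epsilon>)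
    = (\<chi> s a. if s \<noteq> Terminal \<and> a = Continue then \<gamma>\<^sup>2 * \<epsilon>\<^sup>2 else 0)" (is "_ = ?D")
proof (rule gradient_eqI)
  \<comment> \<open>The gradient is taken in all coordinates, so the closed form must hold on an
    open neighbourhood in the ambient space. At the policy itself the defining condition reads
    \<open>\<gamma> \<noteq> 1\<close>.\<close>
  let ?U = "{\<pi> :: real ^ choice ^ stage.
    \<gamma> * (\<pi> $ Terminal $ Stop + \<pi> $ Terminal $ Continue) \<noteq> 1}"
  have "((\<lambda>\<pi> :: real ^ choice ^ stage.
      \<gamma>\<^sup>2 * (\<pi> $ S0 $ Continue * \<pi> $ S1 $ Continue * \<pi> $ S2 $ Continue))
    has_derivative (\<lambda>h. h \<bullet> ?D)) (at (uniform_policy \<epsilon>))"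
    by (rule has_derivative_eq_rhs, (rule derivative_intros
          bounded_linear.has_derivative[OF bounded_linear_vec_nth])+)
      (simp add: fun_eq_iff uniform_policy_def inner_vec_def sum_stage sum_choice
        power2_eq_square algebra_simps)
  then show "GDERIV (\<lambda>\<pi>. - expected_return (exit_cost_chain \<gamma>) (return_pmf S0) \<pi>)
      (uniform_policy \<epsilon>) :> ?D"
    unfolding gderiv_def
  proof (rule has_derivative_transform_within_open)
    show "open ?U"
      by (intro open_Collect_neq continuous_intros)
    show "uniform_policy \<epsilon> \<in> ?U"
      using assms by (simp add: uniform_policy_def)
  qed (simp add: expected_return_exit_cost_chain)
qed

lemma policy_residual_uniform_policy:
  assumes "0 < \<gamma>" and "\<gamma> < 1" and "0 < \<epsilon>" and "\<epsilon> < 1"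
  shows "(policy_residual (exit_cost_chain \<gamma>) (return_pmf S0) (uniform_policy \<epsilon>))\<^sup>2
    = 3 / 2 * \<gamma> ^ 4 * \<epsilon> ^ 4"
proof -
  define k where "k = \<gamma>\<^sup>2 * \<epsilon>\<^sup>2"
  define g :: "real ^ choice ^ stage" where
    "g = (\<chi> s a. if s \<noteq> Terminal \<and> a = Continue then k else 0)"
  \<comment> \<open>The projection of \<open>g\<close> onto directions with zero sum in each state:
    at each of the three stages the mean \<open>k / 2\<close> is subtracted from the pair
    \<open>(0, k)\<close>.\<close>
  define w :: "real ^ choice ^ stage" where
    "w = (\<chi> s a. if s = Terminal then 0 else if a = Continue then k / 2 else - k / 2)"
  have grad: "gradient (\<lambda>\<pi>. - expected_return (exit_cost_chain \<gamma>) (return_pmf S0) \<pi>)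
      (uniform_policy \<epsilon>) = g"
    unfolding g_def k_def by (rule gradient_uniform_policy[OF assms(2)])
  \<comment> \<open>This leads to \<open>k \<le> \<epsilon>\<close>, which keeps the continuation
    probability \<open>\<epsilon> - k / 2\<close> nonnegative after a full step along
    \<open>- w\<close>.\<close>
  have "\<gamma>\<^sup>2 * \<epsilon> \<le> 1"
    using assms by (intro mult_le_one) (simp_all add: power_le_one)
  then have "k \<le> \<epsilon>"
    using assms mult_right_mono[of "\<gamma>\<^sup>2 * \<epsilon>" 1 \<epsilon>] by (simp add: k_def power2_eq_square mult.assoc)
  have "0 \<le> k"
    by (simp add: k_def)
  have uniform: "uniform_policy \<epsilon> \<in> policies"
    using assms by (simp add: uniform_policy_in_policies)
  have shifted: "uniform_policy \<epsilon> - w \<in> policies"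
    using assms \<open>0 \<le> k\<close> \<open>k \<le> \<epsilon>\<close>
    by (auto simp: policies_def uniform_policy_def w_def sum_choice)
  have "infdist 0 ((+) g ` normal_cone policies (uniform_policy \<epsilon>)) = norm w"
  proof (rule infdist_zero_eq_normI)
    \<comment> \<open>In each state \<open>w - g\<close> takes the same value on both actions,
      whereas differences of policies sum to zero there.\<close>
    have "(w - g) \<bullet> (\<pi> - uniform_policy \<epsilon>) = 0" if "\<pi> \<in> policies" for \<pi>
    proof -
      have stop: "\<pi> $ s $ Stop = 1 - \<pi> $ s $ Continue" for s
        using that by (simp add: policies_def sum_choice eq_diff_eq)
      then show ?thesis
        by (simp add: inner_vec_def sum_stage sum_choice w_def g_def uniform_policy_def stop
            algebra_simps)
    qed
    then have "w - g \<in> normal_cone policies (uniform_policy \<epsilon>)"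
      using uniform by (simp add: normal_cone_def)
    then show "w \<in> (+) g ` normal_cone policies (uniform_policy \<epsilon>)"
      by (rule rev_image_eqI) simp
  next
    fix x
    assume "x \<in> (+) g ` normal_cone policies (uniform_policy \<epsilon>)"
    then obtain v where v: "v \<in> normal_cone policies (uniform_policy \<epsilon>)" "x = g + v"
      by auto
    \<comment> \<open>Testing the normal cone inequality at the shifted policy yields
      \<open>0 \<le> v \<bullet> w\<close>; with \<open>g \<bullet> w = w \<bullet> w\<close>, a
      property of the projection, this is the variational inequality.\<close>
    have "v \<bullet> (uniform_policy \<epsilon> - w - uniform_policy \<epsilon>) \<le> 0"
      using v(1) shifted unfolding normal_cone_def by blast
    then have "0 \<le> v \<bullet> w"
      by simp
    moreover have "g \<bullet> w = w \<bullet> w"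
      by (simp add: inner_vec_def sum_stage sum_choice w_def g_def)
    ultimately show "w \<bullet> w \<le> x \<bullet> w"
      by (simp add: v(2) inner_add_left)
  qed
  then have "(policy_residual (exit_cost_chain \<gamma>) (return_pmf S0) (uniform_policy \<epsilon>))\<^sup>2 = w \<bullet> w"
    by (simp add: policy_residual_def grad power2_norm_eq_inner)
  also have "\<dots> = 3 / 2 * k\<^sup>2"
    by (simp add: inner_vec_def sum_stage sum_choice w_def power2_eq_square)
  also have "\<dots> = 3 / 2 * \<gamma> ^ 4 * \<epsilon> ^ 4"
    by (simp add: k_def power_mult_distrib)
  finally show ?thesis .
qed

theorem proposition6p6:
  fixes \<gamma> :: real
  assumes "0 < \<gamma>" and "\<gamma> < 1"
  shows "\<exists>(M :: (stage, choice) mdp) (\<mu> :: stage pmf)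
            (pi_star :: real ^ choice ^ stage) (pi_eps :: real \<Rightarrow> real ^ choice ^ stage).
    three_stage_chain M \<and> discount M = \<gamma> \<and> \<mu> = return_pmf S0 \<and>
    is_arg_max (expected_return M \<mu>) (\<lambda>\<pi>. \<pi> \<in> policies) pi_star \<and>
    (\<forall>\<epsilon>. 0 < \<epsilon> \<and> \<epsilon> < 1 \<longrightarrow>
       pi_eps \<epsilon> \<in> policies \<and>
       expected_return M \<mu> pi_star - expected_return M \<mu> (pi_eps \<epsilon>) = \<gamma> ^ 2 * \<epsilon> ^ 3 \<and>
       (policy_residual M \<mu> (pi_eps \<epsilon>)) ^ 2 = 3 / 2 * \<gamma> ^ 4 * \<epsilon> ^ 4) \<and>
    \<not> (\<exists>C :: real. \<forall>\<pi> \<in> policies.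
         expected_return M \<mu> pi_star - expected_return M \<mu> \<pi> \<le> C * (policy_residual M \<mu> \<pi>) ^ 2)"
proof -
  let ?J = "expected_return (exit_cost_chain \<gamma>) (return_pmf S0)"
  let ?R = "policy_residual (exit_cost_chain \<gamma>) (return_pmf S0)"
  have gap: "?J (uniform_policy 0) - ?J (uniform_policy \<epsilon>) = \<gamma> ^ 2 * \<epsilon> ^ 3"
    if "0 < \<epsilon>" "\<epsilon> < 1" for \<epsilon>
    using assms that by (simp add: expected_return_uniform_policy)
  have res: "(?R (uniform_policy \<epsilon>)) ^ 2 = 3 / 2 * \<gamma> ^ 4 * \<epsilon> ^ 4"
    if "0 < \<epsilon>" "\<epsilon> < 1" for \<epsilon>
    using assms that by (rule policy_residual_uniform_policy)
  have "\<exists>\<pi>\<in>policies. C * (?R \<pi>) ^ 2 < ?J (uniform_policy 0) - ?J \<pi>" for C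
  proof
    \<comment> \<open>The gap divided by the squared residual is
      \<open>2 / (3 * \<gamma>\<^sup>2 * \<epsilon>)\<close>, unbounded as \<epsilon> tends to zero.
      This choice gives \<open>\<bar>C\<bar> * \<epsilon> < 1 / 2\<close>; the absolute value also
      covers negative \<open>C\<close>.\<close>
    define \<epsilon> where "\<epsilon> = 1 / (2 + 2 * \<bar>C\<bar>)"
    have \<epsilon>: "0 < \<epsilon>" "\<epsilon> < 1" "3 / 2 * \<bar>C\<bar> * \<epsilon> < 1"
      by (simp_all add: \<epsilon>_def field_simps)
    show "uniform_policy \<epsilon> \<in> policies"
      using \<epsilon> by (simp add: uniform_policy_in_policies)
    have "C * (3 / 2 * \<gamma> ^ 4 * \<epsilon> ^ 4) \<le> \<bar>C\<bar> * (3 / 2 * \<gamma> ^ 4 * \<epsilon> ^ 4)"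
      by (rule mult_right_mono) simp_all
    also have "\<dots> = \<gamma> ^ 4 * \<epsilon> ^ 3 * (3 / 2 * \<bar>C\<bar> * \<epsilon>)"
      by (simp add: power_numeral_reduce)
    also have "\<dots> < \<gamma> ^ 4 * \<epsilon> ^ 3 * 1"
      using \<epsilon> assms by (intro mult_strict_left_mono) simp_all
    also have "\<dots> \<le> \<gamma> ^ 2 * \<epsilon> ^ 3"
      using \<epsilon> assms by (simp add: power_decreasing)
    finally show "C * (?R (uniform_policy \<epsilon>)) ^ 2
        < ?J (uniform_policy 0) - ?J (uniform_policy \<epsilon>)"
      unfolding gap[OF \<epsilon>(1,2)] res[OF \<epsilon>(1,2)] .
  qed
  then have "\<not> (\<exists>C. \<forall>\<pi>\<in>policies. ?J (uniform_policy 0) - ?J \<pi> \<le> C * (?R \<pi>) ^ 2)"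
    by (metis not_less)
  moreover have "three_stage_chain (exit_cost_chain \<gamma>)" "discount (exit_cost_chain \<gamma>) = \<gamma>"
    using assms by (simp_all add: three_stage_exit_cost_chain) (simp add: exit_cost_chain_def)
  moreover have "uniform_policy \<epsilon> \<in> policies" if "0 < \<epsilon>" "\<epsilon> < 1" for \<epsilon>
    using that by (simp add: uniform_policy_in_policies)
  ultimately show ?thesis
    using gap res never_continue_optimal[OF assms(2)]
    by (intro exI[of _ "exit_cost_chain \<gamma>"] exI[of _ "return_pmf S0"]
        exI[of _ "uniform_policy 0"] exI[of _ uniform_policy]) blast
qed

end
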